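(* Let $T\in G$ be a hyperbolic isometry. Then: (1) $T$ is non-unitary normal up to conjugacy, i.e. there is $R\in G$ such that $RTR^{-1}$ is, as an operator on the Hilbert space $H\oplus\mathbb{C}$, normal but not unitary. (2) The spectrum of $T$ contains two eigenvalues of the form $re^{i\theta}$ and $r^{-1}e^{i\theta}$ where $r>0$, $r\neq 1$ (and $\theta\in\mathbb{R}$). The eigenspaces of these eigenvalues are one-dimensional, each generated by a light-like eigenvector. The rest of the spectral values lie on $S^1$. (3) Let $(y_1,1)$ and $(y_2,1)$ be the light-like eigenvectors of $T$ (with $y_1\ne y_2$) and $M=\operatorname{span}\{(y_1,1),(y_2,1)\}$. Then $H\oplus\mathbb{C}=M\oplus M^{\dagger}$ and $T=T_1\oplus T_2$, where $T_1=T|_M$ and $T_2=T|_{M^{\dagger}}$. Moreover $T_2\in\mathcal{U}(M^{\dagger})$.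
   Context: $H$ is a complex Hilbert space with inner product $\langle\cdot,\cdot\rangle$ (linear in the first variable), $B$ its open unit ball. $H\oplus\mathbb{C}$ is the Hilbert space direct sum. $\mathcal{A}((x,z),(y,w))=\langle x,y\rangle-z\overline{w}$ is a Hermitian form on $H\oplus\mathbb{C}$, and $\mathcal{Q}(v)=\mathcal{A}(v,v)$. $G$ is the group of all bijective bounded linear operators on $H\oplus\mathbb{C}$ preserving $\mathcal{A}$; its elements are called isometries. Each $T\in G$ acts on $\overline{B}$ by $\widetilde{T}(x)=y/w$ where $T(x,1)=(y,w)$ (one has $w\neq 0$). $T$ is elliptic if $\widetilde{T}$ has a fixed point in $B$; $T$ is hyperbolic if it is not elliptic and $\widetilde{T}$ has exactly two fixed points in $\overline{B}$, lying on $\partial B$. A nonzero vector $v$ is light-like if $\mathcal{Q}(v)=0$. For a subspace $M$, $M^{\dagger}=\{v:\mathcal{A}(v,m)=0\ \forall m\in M\}$. When $\mathcal{A}|_{M^\dagger}$ is positive definite and complete, $M^\dagger$ is regarded as a Hilbert space with inner product $\mathcal{A}|_{M^{\dagger}}$ and $\mathcal{U}(M^{\dagger})$ is its unitary group (that this applies is part of the assertion). $S^1$ is the unit circle in $\mathbb{C}$. An operator $N$ is normal if $NN^*=N^*N$. *)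

theory Defs
  imports "HOL-Analysis.Analysis"
begin

section \<open>Complex Hilbert spaces\<close>

class complex_vector = real_vector +
  fixes scaleC :: "complex \<Rightarrow> 'a \<Rightarrow> 'a"  (infixr \<open>*\<^sub>C\<close> 75)
  assumes scaleC_add_right: "a *\<^sub>C (x + y) = a *\<^sub>C x + a *\<^sub>C y"
    and scaleC_add_left: "(a + b) *\<^sub>C x = a *\<^sub>C x + b *\<^sub>C x"
    and scaleC_scaleC: "a *\<^sub>C (b *\<^sub>C x) = (a * b) *\<^sub>C x"
    and scaleC_one: "1 *\<^sub>C x = x"
    and scaleR_scaleC: "scaleR r x = complex_of_real r *\<^sub>C x"

global_interpretation complex_vector: vector_space "scaleC :: complex \<Rightarrow> 'a \<Rightarrow> 'a::complex_vector"
  by unfold_locales (fact scaleC_add_right scaleC_add_left scaleC_scaleC scaleC_one)+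

text \<open>The inner product is linear in the first variable.\<close>

class complex_inner = complex_vector + real_normed_vector +
  fixes cinner :: "'a \<Rightarrow> 'a \<Rightarrow> complex"
  assumes cinner_commute: "cinner x y = cnj (cinner y x)"
    and cinner_add_left: "cinner (x + y) z = cinner x z + cinner y z"
    and cinner_scaleC_left: "cinner (a *\<^sub>C x) y = a * cinner x y"
    and cinner_self: "cinner x x = complex_of_real ((norm x)\<^sup>2)"

class complex_hilbert = complex_inner + complete_space

instantiation complex :: complex_hilbert
begin

definition "scaleC a (z::complex) = a * z"

definition "cinner (z::complex) w = z * cnj w"

instance
  by standard (simp_all add: scaleC_complex_def cinner_complex_def algebra_simps
      scaleR_conv_of_real complex_norm_square[symmetric])

end

text \<open>The Hilbert space direct sum; the library's norm on products is
  \<open>norm (x, y) = sqrt ((norm x)\<^sup>2 + (norm y)\<^sup>2)\<close>.\<close>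

instantiation prod :: (complex_vector, complex_vector) complex_vector
begin

definition "scaleC a (p::'a \<times> 'b) = (a *\<^sub>C fst p, a *\<^sub>C snd p)"

instance
  by standard (simp_all add: scaleC_prod_def scaleC_add_right scaleC_add_left scaleC_scaleC
      scaleC_one scaleR_scaleC scaleR_prod_def)

end

instantiation prod :: (complex_inner, complex_inner) complex_inner
begin

definition "cinner (p::'a \<times> 'b) q = cinner (fst p) (fst q) + cinner (snd p) (snd q)"

instance
proof
  fix x y :: "'a \<times> 'b"
  show "cinner x y = cnj (cinner y x)"
    unfolding cinner_prod_def
    by (metis cinner_commute complex_cnj_add)
qed (simp_all add: cinner_prod_def scaleC_prod_def cinner_add_left cinner_scaleC_left
    cinner_self norm_prod_def algebra_simps)

end

instance prod :: (complex_hilbert, complex_hilbert) complex_hilbert ..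


section \<open>Operators\<close>

definition bounded_clinear :: "('a::complex_inner \<Rightarrow> 'b::complex_inner) \<Rightarrow> bool" where
  "bounded_clinear T \<longleftrightarrow> bounded_linear T \<and> (\<forall>c x. T (c *\<^sub>C x) = c *\<^sub>C T x)"

definition spectrum :: "('a::complex_inner \<Rightarrow> 'a) \<Rightarrow> complex set" where
  "spectrum T = {c. \<not> (\<exists>S. bounded_clinear S \<and>
      (\<forall>x. S (T x - c *\<^sub>C x) = x) \<and> (\<forall>x. T (S x) - c *\<^sub>C S x = x))}"

definition eigenspace :: "('a::complex_vector \<Rightarrow> 'a) \<Rightarrow> complex \<Rightarrow> 'a set" where
  "eigenspace T c = {v. T v = c *\<^sub>C v}"

definition eigenvalue :: "('a::complex_vector \<Rightarrow> 'a) \<Rightarrow> complex \<Rightarrow> bool" where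
  "eigenvalue T c \<longleftrightarrow> (\<exists>v. v \<noteq> 0 \<and> T v = c *\<^sub>C v)"

definition eigenvector :: "('a::complex_vector \<Rightarrow> 'a) \<Rightarrow> 'a \<Rightarrow> bool" where
  "eigenvector T v \<longleftrightarrow> v \<noteq> 0 \<and> (\<exists>c. T v = c *\<^sub>C v)"


subsection \<open>Subspaces carrying their own inner product\<close>

text \<open>A linear subspace \<open>K\<close> with a form \<open>ip\<close> may be a Hilbert space although \<open>ip\<close> is indefinite
  on the ambient space, so the following notions refer to \<open>ip\<close> on \<open>K\<close> only. The whole space \<open>H\<close>
  with its own inner product is the case \<open>K = UNIV\<close>, \<open>ip = cinner\<close>. The absolute value in
  the distance is irrelevant on \<open>K\<close>; off \<open>K\<close>, it keeps the distance nonnegative, as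
  \<^locale>\<open>Metric_space\<close> requires.\<close>

definition hilbert_space_on :: "'a::complex_vector set \<Rightarrow> ('a \<Rightarrow> 'a \<Rightarrow> complex) \<Rightarrow> bool" where
  "hilbert_space_on K ip \<longleftrightarrow>
     complex_vector.subspace K \<and>
     (\<forall>x\<in>K. \<forall>y\<in>K. ip x y = cnj (ip y x)) \<and>
     (\<forall>x\<in>K. \<forall>y\<in>K. \<forall>z\<in>K. ip (x + y) z = ip x z + ip y z) \<and>
     (\<forall>c. \<forall>x\<in>K. \<forall>y\<in>K. ip (c *\<^sub>C x) y = c * ip x y) \<and>
     (\<forall>x\<in>K. x \<noteq> 0 \<longrightarrow> Re (ip x x) > 0) \<and>
     Metric_space.mcomplete K (\<lambda>x y. sqrt (cmod (ip (x - y) (x - y))))"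

definition clinear_on :: "'a::complex_vector set \<Rightarrow> ('a \<Rightarrow> 'a) \<Rightarrow> bool" where
  "clinear_on K N \<longleftrightarrow> N \<in> K \<rightarrow> K \<and>
     (\<forall>x\<in>K. \<forall>y\<in>K. N (x + y) = N x + N y) \<and> (\<forall>c. \<forall>x\<in>K. N (c *\<^sub>C x) = c *\<^sub>C N x)"

definition adjoint_on ::
  "'a::complex_vector set \<Rightarrow> ('a \<Rightarrow> 'a \<Rightarrow> complex) \<Rightarrow> ('a \<Rightarrow> 'a) \<Rightarrow> ('a \<Rightarrow> 'a) \<Rightarrow> bool" where
  "adjoint_on K ip N N' \<longleftrightarrow> N' \<in> K \<rightarrow> K \<and> (\<forall>x\<in>K. \<forall>y\<in>K. ip (N x) y = ip x (N' y))"

text \<open>On a Hilbert space the adjoint is unique on \<open>K\<close>, and by the closed graph theorem an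
  everywhere defined linear operator having an everywhere defined adjoint is bounded. So no separate
  boundedness condition is needed below.\<close>

definition normal_on ::
  "'a::complex_vector set \<Rightarrow> ('a \<Rightarrow> 'a \<Rightarrow> complex) \<Rightarrow> ('a \<Rightarrow> 'a) \<Rightarrow> bool" where
  "normal_on K ip N \<longleftrightarrow> clinear_on K N \<and>
     (\<exists>N'. adjoint_on K ip N N' \<and> (\<forall>x\<in>K. N (N' x) = N' (N x)))"

definition unitary_on ::
  "'a::complex_vector set \<Rightarrow> ('a \<Rightarrow> 'a \<Rightarrow> complex) \<Rightarrow> ('a \<Rightarrow> 'a) \<Rightarrow> bool" where
  "unitary_on K ip U \<longleftrightarrow> clinear_on K U \<and>
     (\<exists>U'. adjoint_on K ip U U' \<and> (\<forall>x\<in>K. U (U' x) = x \<and> U' (U x) = x))"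


subsection \<open>Direct sums\<close>

definition direct_sum :: "'a::complex_vector set \<Rightarrow> 'a set \<Rightarrow> bool" where
  "direct_sum M N \<longleftrightarrow> complex_vector.subspace M \<and> complex_vector.subspace N \<and>
     (\<forall>v. \<exists>m\<in>M. \<exists>n\<in>N. v = m + n) \<and> M \<inter> N = {0}"

definition operator_direct_sum ::
  "'a::complex_vector set \<Rightarrow> 'a set \<Rightarrow> ('a \<Rightarrow> 'a) \<Rightarrow> ('a \<Rightarrow> 'a) \<Rightarrow> ('a \<Rightarrow> 'a) \<Rightarrow> bool" where
  "operator_direct_sum M N T T\<^sub>1 T\<^sub>2 \<longleftrightarrow> T\<^sub>1 \<in> M \<rightarrow> M \<and> T\<^sub>2 \<in> N \<rightarrow> N \<and>
     (\<forall>m\<in>M. \<forall>n\<in>N. T (m + n) = T\<^sub>1 m + T\<^sub>2 n)"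


section \<open>Isometries of the indefinite form\<close>

definition formA :: "'a::complex_hilbert \<times> complex \<Rightarrow> 'a \<times> complex \<Rightarrow> complex" where
  "formA v w = cinner (fst v) (fst w) - snd v * cnj (snd w)"

definition formQ :: "'a::complex_hilbert \<times> complex \<Rightarrow> complex" where
  "formQ v = formA v v"

definition light_like :: "'a::complex_hilbert \<times> complex \<Rightarrow> bool" where
  "light_like v \<longleftrightarrow> v \<noteq> 0 \<and> formQ v = 0"

definition dagger :: "('a::complex_hilbert \<times> complex) set \<Rightarrow> ('a \<times> complex) set" where
  "dagger M = {v. \<forall>m\<in>M. formA v m = 0}"

definition isometries :: "('a::complex_hilbert \<times> complex \<Rightarrow> 'a \<times> complex) set" where
  "isometries = {T. bounded_clinear T \<and> bij T \<and> (\<forall>v w. formA (T v) (T w) = formA v w)}"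

definition ball_action ::
  "('a::complex_hilbert \<times> complex \<Rightarrow> 'a \<times> complex) \<Rightarrow> 'a \<Rightarrow> 'a" where
  "ball_action T x = (case T (x, 1) of (y, w) \<Rightarrow> inverse w *\<^sub>C y)"

definition elliptic :: "('a::complex_hilbert \<times> complex \<Rightarrow> 'a \<times> complex) \<Rightarrow> bool" where
  "elliptic T \<longleftrightarrow> (\<exists>x\<in>ball 0 1. ball_action T x = x)"

definition hyperbolic :: "('a::complex_hilbert \<times> complex \<Rightarrow> 'a \<times> complex) \<Rightarrow> bool" where
  "hyperbolic T \<longleftrightarrow> \<not> elliptic T \<and>
     card {x \<in> cball 0 1. ball_action T x = x} = 2 \<and>
     {x \<in> cball 0 1. ball_action T x = x} \<subseteq> sphere 0 1"

end

theory Submission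
  imports Defs
begin

text \<open>
  Let \<open>p\<^sub>1\<close>, \<open>p\<^sub>2\<close> be the light-like eigenvectors given by the two fixed points, with eigenvalues
  \<open>\<lambda>\<close>, \<open>\<mu>\<close>. Two distinct light-like lines are never orthogonal for \<open>A\<close>, so invariance forces
  \<open>\<lambda> cnj \<mu> = 1\<close>; if \<open>\<bar>\<lambda>\<bar> = 1\<close>, then \<open>\<lambda> = \<mu>\<close>, and a suitable combination of \<open>p\<^sub>1\<close> and \<open>p\<^sub>2\<close> is a negative
  eigenvector, which makes \<open>T\<close> elliptic. Rescale to \<open>f\<close>, \<open>g\<close> with \<open>A(f, g) = -1/2\<close> such that
  \<open>q = f + g\<close>, for which \<open>Q(q) = -1\<close>, has a positive last coordinate. The reflection \<open>R\<close> in
  \<open>q - (0, 1)\<close> swaps \<open>q\<close> and \<open>(0, 1)\<close>, so it maps \<open>M\<^sup>\<dagger>\<close> into \<open>H\<close>. Hence \<open>Q(v) = \<parallel>R v\<parallel>\<^sup>2\<close> on \<open>M\<^sup>\<dagger>\<close>,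
  which makes \<open>M\<^sup>\<dagger>\<close> a Hilbert space on which \<open>T\<close> is unitary, and \<open>R T R\<close> is normal because its
  eigenvectors \<open>R f\<close>, \<open>R g\<close> are orthogonal to each other and to \<open>R M\<^sup>\<dagger>\<close>. For \<open>\<bar>c\<bar> \<noteq> 1\<close> the
  equation \<open>T v - c v = w\<close> in \<open>M\<^sup>\<dagger>\<close> is a fixed point problem for a contraction.
\<close>

section \<open>Complex inner product spaces\<close>

lemma scaleC_minus_left: "(- c) *\<^sub>C x = - (c *\<^sub>C (x::'a::complex_vector))"
  and scaleC_minus_right: "c *\<^sub>C (- x) = - (c *\<^sub>C (x::'a::complex_vector))"
  and scaleC_diff_left: "(c - d) *\<^sub>C x = c *\<^sub>C x - d *\<^sub>C (x::'a::complex_vector)"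
  and scaleC_diff_right: "c *\<^sub>C (x - y) = c *\<^sub>C x - c *\<^sub>C (y::'a::complex_vector)"
  by (simp_all add: complex_vector.scale_left_diff_distrib complex_vector.scale_right_diff_distrib)

lemmas scaleC_simps = scaleC_add_right scaleC_add_left scaleC_minus_left scaleC_minus_right
  scaleC_diff_left scaleC_diff_right

lemma cinner_add_right: "cinner x (y + z) = cinner x y + cinner x (z::'a::complex_inner)"
  by (metis cinner_add_left cinner_commute complex_cnj_add)

lemma cinner_scaleC_right: "cinner x (c *\<^sub>C y) = cnj c * cinner x (y::'a::complex_inner)"
  by (metis cinner_commute cinner_scaleC_left complex_cnj_mult)

lemma cinner_zero_left [simp]: "cinner 0 (x::'a::complex_inner) = 0"
  using cinner_scaleC_left[of 0 0 x] by simp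

lemma cinner_diff_left: "cinner (x - y) z = cinner x z - cinner y (z::'a::complex_inner)"
  by (metis add_diff_cancel cinner_add_left diff_add_cancel)

lemma cinner_diff_right: "cinner x (y - z) = cinner x y - cinner x (z::'a::complex_inner)"
  by (metis add_diff_cancel cinner_add_right diff_add_cancel)

lemma norm_scaleC: "norm (c *\<^sub>C x) = cmod c * norm (x::'a::complex_inner)"
proof -
  have "complex_of_real ((norm (c *\<^sub>C x))\<^sup>2) = c * cnj c * complex_of_real ((norm x)\<^sup>2)"
    by (simp only: cinner_self[symmetric] cinner_scaleC_left cinner_scaleC_right mult_ac)
  also have "\<dots> = complex_of_real ((cmod c * norm x)\<^sup>2)"
    by (simp add: complex_norm_square[symmetric] power_mult_distrib)
  finally have "(norm (c *\<^sub>C x))\<^sup>2 = (cmod c * norm x)\<^sup>2"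
    using of_real_eq_iff by blast
  then show ?thesis
    by (simp add: power2_eq_iff_nonneg)
qed

lemma cinner_Cauchy_Schwarz: "cmod (cinner x y) \<le> norm x * norm (y::'a::complex_inner)"
proof (cases "y = 0")
  case True
  then show ?thesis
    using cinner_commute[of x 0] by simp
next
  case False
  \<comment> \<open>\<open>s x - c y\<close> is \<open>s\<close> times the component of
    \<open>x\<close> orthogonal to \<open>y\<close>. Its squared norm is \<open>s\<close> times the
    difference of the squared sides of the inequality.\<close>
  define s where "s = complex_of_real ((norm y)\<^sup>2)"
  define c where "c = cinner x y"
  have yx: "cinner y x = cnj c"
    unfolding c_def by (rule cinner_commute)
  have s: "s = cinner y y" "cnj s = s"
    by (simp_all add: s_def cinner_self)
  have "complex_of_real ((norm (s *\<^sub>C x - c *\<^sub>C y))\<^sup>2) =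
      s * (s * cinner x x - c * cnj c)"
    unfolding cinner_self[symmetric]
    by (simp add: cinner_diff_left cinner_diff_right cinner_scaleC_left cinner_scaleC_right
        yx c_def[symmetric] s(1)[symmetric] s(2) algebra_simps)
  also have "\<dots> = complex_of_real ((norm y)\<^sup>2 * ((norm y)\<^sup>2 * (norm x)\<^sup>2 - (cmod c)\<^sup>2))"
    by (simp add: s_def cinner_self complex_norm_square[symmetric] del: of_real_power)
  finally have "(norm y)\<^sup>2 * ((norm y)\<^sup>2 * (norm x)\<^sup>2 - (cmod c)\<^sup>2) \<ge> 0"
    by (metis of_real_eq_iff zero_le_power2)
  then have "(norm y)\<^sup>2 * (norm x)\<^sup>2 - (cmod c)\<^sup>2 \<ge> 0"
    using False by (simp add: zero_le_mult_iff)
  then have "(cmod c)\<^sup>2 \<le> (norm x * norm y)\<^sup>2"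
    by (simp add: power_mult_distrib mult.commute)
  then show ?thesis
    unfolding c_def by (rule power2_le_imp_le) simp
qed

section \<open>Bounded operators and their spectrum\<close>

lemma bounded_clinearI:
  assumes "\<And>x y. S (x + y) = S x + S y" "\<And>c x. S (c *\<^sub>C x) = c *\<^sub>C S x"
    "\<And>x. norm (S x) \<le> B * norm x"
  shows "bounded_clinear S"
  unfolding bounded_clinear_def
  using assms by (auto intro!: bounded_linear_intro[where K = B] simp: scaleR_scaleC mult.commute)

lemma bounded_clinear_compose:
  "bounded_clinear S \<Longrightarrow> bounded_clinear T \<Longrightarrow> bounded_clinear (S \<circ> T)"
  unfolding bounded_clinear_def by (auto simp: o_def intro: bounded_linear_compose)

lemma bounded_clinear_simps:
  assumes "bounded_clinear S"
  shows "S (x + y) = S x + S y" "S (x - y) = S x - S y" "S (c *\<^sub>C x) = c *\<^sub>C S x"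
    "S (- x) = - S x" "S 0 = 0"
  using assms unfolding bounded_clinear_def
  by (auto dest!: bounded_linear.linear simp: linear_add linear_diff linear_neg linear_0)

text \<open>The lower bound gives injectivity and at the same time bounds the inverse, so
  \<open>inv L\<close> is a bounded resolvent.\<close>

lemma spectrum_complementI:
  assumes T: "bounded_clinear T"
    and bound: "\<And>v. norm v \<le> B * norm (T v - c *\<^sub>C v)"
    and surj: "\<And>w. \<exists>v. T v - c *\<^sub>C v = w"
  shows "c \<notin> spectrum T"
proof -
  define L where "L v = T v - c *\<^sub>C v" for v
  have add: "L (x + y) = L x + L y" and scale: "L (a *\<^sub>C x) = a *\<^sub>C L x"
    and diff: "L (x - y) = L x - L y" for x y a
    unfolding L_def by (simp_all add: bounded_clinear_simps[OF T] scaleC_simps mult.commute)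
  have "inj L"
  proof (rule injI)
    fix x y assume "L x = L y"
    then have "L (x - y) = 0" by (simp add: diff)
    then have "norm (x - y) \<le> 0"
      using bound[of "x - y"] by (simp add: L_def)
    then show "x = y" by simp
  qed
  then have S: "inv L (L x) = x" for x by simp
  have "surj L"
    unfolding surj_def L_def using surj by metis
  then have S': "L (inv L x) = x" for x by (simp add: surj_f_inv_f)
  have "bounded_clinear (inv L)"
  proof (rule bounded_clinearI[where B = B])
    show "inv L (x + y) = inv L x + inv L y" for x y by (metis S S' add)
    show "inv L (a *\<^sub>C x) = a *\<^sub>C inv L x" for a x by (metis S S' scale)
    show "norm (inv L x) \<le> B * norm x" for x
      using bound[of "inv L x"] S'[of x] by (simp add: L_def)
  qed
  then show ?thesis
    unfolding spectrum_def using S S' unfolding L_def by blast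
qed

lemma eigenvalue_in_spectrum:
  assumes "eigenvalue T c"
  shows "c \<in> spectrum T"
proof -
  obtain v where "v \<noteq> 0" "T v = c *\<^sub>C v"
    using assms unfolding eigenvalue_def by blast
  then show ?thesis
    unfolding spectrum_def using bounded_clinear_simps(5) by (smt (verit) diff_self mem_Collect_eq)
qed


section \<open>The indefinite form\<close>

lemma formA_add_left: "formA (u + v) w = formA u w + formA v w"
  and formA_add_right: "formA w (u + v) = formA w u + formA w v"
  and formA_diff_left: "formA (u - v) w = formA u w - formA v w"
  and formA_diff_right: "formA w (u - v) = formA w u - formA w v"
  and formA_scaleC_left: "formA (c *\<^sub>C u) w = c * formA u w"
  and formA_scaleC_right: "formA w (c *\<^sub>C u) = cnj c * formA w u"
  by (simp_all add: formA_def cinner_add_left cinner_add_right cinner_diff_left cinner_diff_right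
      cinner_scaleC_left cinner_scaleC_right scaleC_prod_def scaleC_complex_def algebra_simps)

lemmas formA_simps = formA_add_left formA_add_right formA_diff_left formA_diff_right
  formA_scaleC_left formA_scaleC_right

lemma formA_commute: "formA v w = cnj (formA w v)"
  unfolding formA_def by (simp add: cinner_commute[of "fst v"] mult.commute)

lemma formA_zero [simp]: "formA 0 v = 0" "formA v 0 = 0"
  using formA_scaleC_left[of 0 0 v] formA_scaleC_right[of v 0 0] by simp_all

lemma formA_self: "formA v v = complex_of_real ((norm (fst v))\<^sup>2 - (cmod (snd v))\<^sup>2)"
  unfolding formA_def cinner_self by (simp add: complex_norm_square[symmetric])

text \<open>Cauchy-Schwarz bounds each of the two summands of the form by
  \<open>norm v * norm w\<close>; the crude factor 2 is enough for continuity and for the resolvent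
  estimates.\<close>

lemma cmod_formA_le: "cmod (formA v w) \<le> 2 * norm v * norm w"
proof -
  have "cmod (formA v w) \<le> norm (fst v) * norm (fst w) + cmod (snd v) * cmod (snd w)"
    unfolding formA_def
    by (rule order.trans[OF norm_triangle_ineq4])
      (simp add: cinner_Cauchy_Schwarz norm_mult)
  also have "\<dots> \<le> norm v * norm w + norm v * norm w"
    by (intro add_mono mult_mono) (simp_all add: norm_prod_def real_le_rsqrt)
  finally show ?thesis by simp
qed

lemma dagger_span_pair:
  "dagger (complex_vector.span {f, g}) = {v. formA v f = 0 \<and> formA v g = 0}"
proof -
  have "formA v m = 0"
    if "formA v f = 0" "formA v g = 0" "m \<in> complex_vector.span {f, g}" for v m
    using that(3)
    by (induction rule: complex_vector.span_induct_alt) (use that in \<open>auto simp: formA_simps\<close>)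
  moreover have "f \<in> complex_vector.span {f, g}" "g \<in> complex_vector.span {f, g}"
    by (auto intro: complex_vector.span_base)
  ultimately show ?thesis
    unfolding dagger_def by auto
qed

lemma subspace_dagger: "complex_vector.subspace (dagger M)"
  unfolding complex_vector.subspace_def dagger_def by (auto simp: formA_simps)

lemma closed_dagger: "closed (dagger M)"
proof -
  have "bounded_linear (\<lambda>v. formA v m)" for m :: "'a \<times> complex"
    by (rule bounded_linear_intro[where K = "2 * norm m"])
      (use cmod_formA_le in \<open>simp_all add: formA_simps scaleR_scaleC scaleC_complex_def mult_ac\<close>)
  then have "closed {v. formA v m = 0}" for m :: "'a \<times> complex"
    by (intro closed_Collect_eq) (simp_all add: linear_continuous_on)
  moreover have "dagger M = (\<Inter>m\<in>M. {v. formA v m = 0})"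
    unfolding dagger_def by auto
  ultimately show ?thesis by auto
qed


subsection \<open>Isometries\<close>

lemma isometriesD:
  assumes "T \<in> isometries"
  shows "bounded_clinear T" "bij T" "formA (T v) (T w) = formA v w"
  using assms unfolding isometries_def by blast+

lemma formA_inv_isometry:
  assumes "T \<in> isometries"
  shows "formA (inv T v) w = formA v (T w)"
  using isometriesD[OF assms] by (metis bij_inv_eq_iff)

text \<open>This makes \<open>ball_action\<close> well defined on the closed ball. With a vanishing
  last coordinate, \<open>Q\<close> of the image would be a squared norm, whereas it equals
  \<open>Q(x, 1) \<le> 0\<close>; the image would be 0, against injectivity.\<close>

lemma isometry_snd_nonzero:
  assumes T: "T \<in> isometries" and "norm x \<le> 1"
  shows "snd (T (x, 1)) \<noteq> 0"
proof
  assume 0: "snd (T (x, 1)) = 0"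
  have "complex_of_real ((norm (fst (T (x, 1))))\<^sup>2) = complex_of_real ((norm x)\<^sup>2 - 1)"
    using isometriesD(3)[OF T, of "(x, 1)" "(x, 1)"] 0 unfolding formA_self by simp
  then have "(norm (fst (T (x, 1))))\<^sup>2 = (norm x)\<^sup>2 - 1"
    unfolding of_real_eq_iff .
  moreover have "(norm x)\<^sup>2 \<le> 1"
    using assms(2) by (simp add: power_le_one)
  ultimately have "(norm (fst (T (x, 1))))\<^sup>2 \<le> 0" by simp
  then have "T (x, 1) = 0"
    using 0 by (simp add: prod_eq_iff)
  then have "T (x, 1) = T 0"
    by (simp add: bounded_clinear_simps[OF isometriesD(1)[OF T]])
  then show False
    using isometriesD(2)[OF T] by (simp add: bij_def inj_eq zero_prod_def)
qed

text \<open>If \<open>T (x, 1) = (y, w)\<close> is a multiple of \<open>(x, 1)\<close>, the factor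
  must be \<open>w\<close>, which is nonzero on the closed ball.\<close>

lemma ball_action_fixed_iff:
  assumes "T \<in> isometries" "norm x \<le> 1"
  shows "ball_action T x = x \<longleftrightarrow> eigenvector T (x, 1)"
proof -
  obtain y w where yw: "T (x, 1) = (y, w)" by fastforce
  then have "w \<noteq> 0"
    using isometry_snd_nonzero[OF assms] by simp
  then have "inverse w *\<^sub>C y = x \<longleftrightarrow> y = w *\<^sub>C x"
    by auto
  then show ?thesis
    unfolding ball_action_def eigenvector_def yw
    by (auto simp: scaleC_prod_def scaleC_complex_def zero_prod_def)
qed

lemma light_like_normalized: "light_like (y, 1) \<longleftrightarrow> norm y = 1"
proof -
  have "formQ (y, 1) = complex_of_real ((norm y)\<^sup>2 - 1)"
    unfolding formQ_def formA_self by simp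
  then have "formQ (y, 1) = 0 \<longleftrightarrow> (norm y)\<^sup>2 = 1"
    by (metis eq_iff_diff_eq_0 of_real_eq_0_iff)
  then show ?thesis
    unfolding light_like_def by (simp add: zero_prod_def power2_eq_1_iff)
     (metis norm_ge_zero zero_le_one le_minus_one_simps(3))
qed


subsection \<open>Reflections\<close>

text \<open>For \<open>n = 0\<close> the division by zero makes the reflection the identity.\<close>

definition reflection ::
  "'a::complex_hilbert \<times> complex \<Rightarrow> 'a \<times> complex \<Rightarrow> 'a \<times> complex" where
  "reflection n v = v - (2 * formA v n / formA n n) *\<^sub>C n"

lemma reflection_add: "reflection n (v + w) = reflection n v + reflection n w"
  unfolding reflection_def
  by (simp add: formA_simps scaleC_simps distrib_left add_divide_distrib)

lemma reflection_scaleC: "reflection n (c *\<^sub>C v) = c *\<^sub>C reflection n v"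
  unfolding reflection_def
  by (simp add: formA_simps scaleC_simps mult_ac)

lemma bounded_clinear_reflection: "bounded_clinear (reflection n)"
proof (rule bounded_clinearI)
  fix v
  have "norm (reflection n v) \<le> norm v + 2 * cmod (formA v n) / cmod (formA n n) * norm n"
    unfolding reflection_def
    by (rule order.trans[OF norm_triangle_ineq4]) (simp add: norm_scaleC norm_mult norm_divide)
  also have "\<dots> \<le> norm v + 2 * (2 * norm v * norm n) / cmod (formA n n) * norm n"
    by (intro add_left_mono mult_right_mono divide_right_mono mult_left_mono cmod_formA_le) auto
  also have "\<dots> = (1 + 4 * norm n * norm n / cmod (formA n n)) * norm v"
    by (simp add: algebra_simps add_divide_distrib)
  finally show "norm (reflection n v) \<le> \<dots>" .
qed (simp_all add: reflection_add reflection_scaleC)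

lemma reflection_involution:
  assumes "n = 0 \<or> formA n n \<noteq> 0"
  shows "reflection n (reflection n v) = v"
proof (cases "n = 0")
  case False
  then have "formA n n \<noteq> 0" using assms by auto
  then show ?thesis
    unfolding reflection_def by (simp add: formA_simps scaleC_simps diff_divide_distrib)
qed (simp add: reflection_def)

lemma reflection_in_isometries:
  assumes "n = 0 \<or> formA n n \<noteq> 0"
  shows "reflection n \<in> isometries"
proof -
  have "bij (reflection n)"
    using reflection_involution[OF assms] by (intro o_bij[of "reflection n" "reflection n"]) (auto simp: fun_eq_iff)
  moreover have "formA (reflection n v) (reflection n w) = formA v w" for v w
  proof (cases "n = 0")
    case False
    then have "formA n n \<noteq> 0" using assms by auto
    moreover have "cnj (formA n n) = formA n n" "cnj (formA w n) = formA n w"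
      by (metis formA_commute)+
    ultimately show ?thesis
      unfolding reflection_def by (simp add: formA_simps field_simps)
  qed (simp add: reflection_def)
  ultimately show ?thesis
    unfolding isometries_def by (simp add: bounded_clinear_reflection)
qed

text \<open>\<open>S\<close> preserves the coefficient in the definition of the reflection. Applied
  to \<open>R\<close>, this relates the reflection in \<open>q\<close> to the one in
  \<open>(0, 1)\<close>.\<close>

lemma reflection_conjugate:
  assumes "S \<in> isometries"
  shows "S (reflection n v) = reflection (S n) (S v)"
  unfolding reflection_def
  by (simp add: bounded_clinear_simps[OF isometriesD(1)[OF assms]] isometriesD(3)[OF assms])


section \<open>Composition, inverses and Hilbert space adjoints of isometries\<close>

lemma isometry_compose:
  assumes "S \<in> isometries" "T \<in> isometries"
  shows "S \<circ> T \<in> isometries"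
  using assms unfolding isometries_def by (simp add: bounded_clinear_compose bij_comp del: split_paired_All)

lemma inv_isometry_linear:
  assumes T: "T \<in> isometries"
  shows "T (inv T v) = v" "inv T (T v) = v" "inv T (v + w) = inv T v + inv T w"
    "inv T (c *\<^sub>C v) = c *\<^sub>C inv T v"
proof -
  show *: "T (inv T v) = v" "inv T (T v) = v" for v
    using isometriesD(2)[OF T] by (simp_all add: bij_is_surj surj_f_inv_f bij_is_inj)
  show "inv T (v + w) = inv T v + inv T w" "inv T (c *\<^sub>C v) = c *\<^sub>C inv T v"
    by (metis * bounded_clinear_simps[OF isometriesD(1)[OF T]])+
qed

lemma formA_axis [simp]: "formA v (0, 1) = - snd v"
  unfolding formA_def by (metis cinner_commute cinner_zero_left complex_cnj_one complex_cnj_zero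
    diff_0 fst_conv mult.right_neutral snd_conv)

text \<open>This is the fundamental symmetry that converts the indefinite form into the inner
  product.\<close>

lemma axis_reflection: "reflection (0, 1) v = (fst v, - snd v)"
  unfolding reflection_def by (simp add: scaleC_prod_def scaleC_complex_def prod_eq_iff)

text \<open>With respect to \<open>formA\<close> the adjoint of \<open>N\<close> is
  \<open>inv N\<close>; passing to \<open>cinner\<close> and back inserts the axis reflection on
  both sides.\<close>

lemma adjoint_isometry:
  assumes "N \<in> isometries"
  shows "adjoint_on UNIV cinner N (\<lambda>v. reflection (0, 1) (inv N (reflection (0, 1) v)))"
proof -
  have *: "cinner v w = formA v (reflection (0, 1) w)"
    for v w :: "'a \<times> complex"
    by (simp add: axis_reflection formA_def cinner_prod_def cinner_complex_def)
  have "formA (N v) w = formA v (inv N w)" for v w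
    by (metis formA_commute formA_inv_isometry[OF assms])
  then show ?thesis
    unfolding adjoint_on_def by (auto simp: * reflection_involution)
qed


section \<open>Pairs of light-like vectors\<close>

text \<open>The value -1/2 makes \<open>Q(f + g) = -1 = Q(0, 1)\<close>. A real last coordinate
  \<open>t\<close> of \<open>q = f + g\<close> makes \<open>A(n, n)\<close> twice
  \<open>A(q, n)\<close> for \<open>n = q - (0, 1)\<close>, which is what lets the reflection in
  \<open>n\<close> send \<open>q\<close> to \<open>(0, 1)\<close>.\<close>

locale light_pair =
  fixes f g :: "'a::complex_hilbert \<times> complex" and t :: real
  assumes ff: "formA f f = 0" and gg: "formA g g = 0" and fg: "formA f g = - 1 / 2"
    and snd_fg: "snd f + snd g = complex_of_real t" and t_pos: "t > 0"
begin

definition q where "q = f + g"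
definition R where "R = reflection (q - (0, 1))"
definition K where "K = dagger (complex_vector.span {f, g})"

lemma gf: "formA g f = - 1 / 2"
  using formA_commute[of g f] fg by simp

lemma q_products: "formA f q = - 1 / 2" "formA g q = - 1 / 2" "formA q q = - 1"
  by (simp_all add: q_def formA_simps ff gg fg gf)

lemma memK: "v \<in> K \<longleftrightarrow> formA v f = 0 \<and> formA v g = 0"
  unfolding K_def dagger_span_pair by simp

lemma subspaceK: "complex_vector.subspace K"
  unfolding K_def by (rule subspace_dagger)

lemma snd_q: "snd q = complex_of_real t"
  by (simp add: q_def snd_fg)

lemma norm_fst_q: "(norm (fst q))\<^sup>2 = t\<^sup>2 - 1"
proof -
  have "complex_of_real ((norm (fst q))\<^sup>2 - (cmod (snd q))\<^sup>2) = complex_of_real (- 1)"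
    using q_products(3) unfolding formA_self by simp
  then show ?thesis
    unfolding of_real_eq_iff by (simp add: snd_q)
qed

lemma axis_difference:
  shows "formA (q - (0, 1)) (q - (0, 1)) = complex_of_real (2 * t - 2)"
    and "formA q (q - (0, 1)) = complex_of_real (t - 1)"
  using formA_commute[of "(0, 1)" q]
  by (simp_all add: formA_diff_left formA_diff_right q_products snd_q)

text \<open>The form vanishes on the difference only for \<open>t = 1\<close>, and then
  \<open>norm_fst_q\<close> forces \<open>q = (0, 1)\<close>. Both cases meet the condition under
  which a reflection is an isometric involution.\<close>

lemma axis_difference_anisotropic:
  "q - (0, 1) = 0 \<or> formA (q - (0, 1)) (q - (0, 1)) \<noteq> 0"
proof (cases "t = 1")
  case True
  then have "q = (0, 1)"
    using norm_fst_q snd_q by (simp add: prod_eq_iff)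
  then show ?thesis by (simp add: zero_prod_def)
next
  case False
  then have "complex_of_real (2 * t - 2) \<noteq> 0"
    by (simp only: of_real_eq_0_iff)
  then show ?thesis by (simp add: axis_difference)
qed

lemma R_isometry: "R \<in> isometries" and R_R [simp]: "R (R v) = v"
  unfolding R_def
  by (rule reflection_in_isometries reflection_involution; rule axis_difference_anisotropic)+

lemma inv_R: "inv R = R"
  by (rule inv_unique_comp) (auto simp: fun_eq_iff)

lemmas R_bounded = isometriesD(1)[OF R_isometry]
lemmas R_simps = bounded_clinear_simps[OF R_bounded]

lemma R_q: "R q = (0, 1)"
proof (cases "q - (0, 1) = 0")
  case True
  then show ?thesis by (simp add: R_def reflection_def)
next
  case False
  then have "complex_of_real (2 * t - 2) \<noteq> 0"
    using axis_difference_anisotropic by (simp add: axis_difference)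
  then have "2 * formA q (q - (0, 1)) / formA (q - (0, 1)) (q - (0, 1)) = 1"
    unfolding axis_difference by simp
  then show ?thesis
    unfolding R_def reflection_def by simp
qed

lemma formA_K:
  assumes "v \<in> K"
  shows "formA v v = complex_of_real ((norm (R v))\<^sup>2)"
proof -
  have "formA v q = 0"
    using assms by (simp add: memK q_def formA_simps)
  then have "formA (R v) (R q) = 0"
    by (simp add: isometriesD(3)[OF R_isometry])
  then have "snd (R v) = 0" by (simp add: R_q)
  moreover have "formA v v = formA (R v) (R v)"
    by (simp add: isometriesD(3)[OF R_isometry])
  ultimately show ?thesis
    unfolding formA_self by (simp add: norm_prod_def)
qed

section \<open>The complement \<open>K\<close> as a Hilbert space, and the projection onto
  it\<close>

abbreviation dK :: "'a \<times> complex \<Rightarrow> 'a \<times> complex \<Rightarrow> real" where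
  "dK \<equiv> \<lambda>x y. sqrt (cmod (formA (x - y) (x - y)))"

lemma dK_eq: "x \<in> K \<Longrightarrow> y \<in> K \<Longrightarrow> dK x y = norm (R x - R y)"
  using formA_K[of "x - y"] complex_vector.subspace_diff[OF subspaceK]
  by (simp add: R_simps norm_power)

lemma R_eq_iff: "R x = R y \<longleftrightarrow> x = y"
  by (metis R_R)

sublocale metricK: Metric_space K dK
proof
  fix x y z
  show "0 \<le> dK x y" by simp
  \<comment> \<open>Symmetry is required off \<open>K\<close> too, where \<open>dK_eq\<close> does
    not apply, so it is taken from \<open>A(-u, -u) = A(u, u)\<close>.\<close>
  show "dK x y = dK y x"
    using formA_scaleC_left[of "-1" "x - y" "x - y"] formA_scaleC_right[of "y - x" "-1" "x - y"]
    by (simp add: scaleC_minus_left)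
  assume K: "x \<in> K" "y \<in> K"
  then show "dK x y = 0 \<longleftrightarrow> x = y"
    unfolding dK_eq[OF K] by (simp add: R_eq_iff)
  assume "z \<in> K"
  then show "dK x z \<le> dK x y + dK y z"
    using K norm_triangle_ineq[of "R x - R y" "R y - R z"] by (simp only: dK_eq) simp
qed

text \<open>\<open>R\<close> turns \<open>dK\<close> into the norm distance, so the images under
  \<open>R\<close> of a Cauchy sequence converge. Applying the continuous involution
  \<open>R\<close> again gives a limit in \<open>K\<close>, because \<open>K\<close> is
  closed.\<close>

lemma mcompleteK: "metricK.mcomplete"
  unfolding metricK.mcomplete_def
proof (intro allI impI)
  fix \<sigma> assume "metricK.MCauchy \<sigma>"
  then have \<sigma>: "\<sigma> n \<in> K" "\<And>\<epsilon>. \<epsilon> > 0 \<Longrightarrow> \<exists>N. \<forall>n n'. N \<le> n \<longrightarrow> N \<le> n' \<longrightarrow> dK (\<sigma> n) (\<sigma> n') < \<epsilon>" for n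
    unfolding metricK.MCauchy_def by auto
  have "Cauchy (\<lambda>n. R (\<sigma> n))"
    unfolding Cauchy_def dist_norm using \<sigma> by (simp only: dK_eq) metis
  then obtain l where l: "(\<lambda>n. R (\<sigma> n)) \<longlonglongrightarrow> l"
    using Cauchy_convergent_iff convergent_def by blast
  have "bounded_linear R"
    using R_bounded unfolding bounded_clinear_def by simp
  then have "\<sigma> \<longlonglongrightarrow> R l"
    using bounded_linear.tendsto[OF _ l] by fastforce
  then have lK: "R l \<in> K"
    using closed_sequentially[of K \<sigma>] \<sigma>(1) closed_dagger unfolding K_def by blast
  have "(\<lambda>n. dK (\<sigma> n) (R l)) \<longlonglongrightarrow> 0"
    unfolding dK_eq[OF \<sigma>(1) lK] using tendsto_norm[OF LIM_zero[OF l]] by simp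
  then have "limitin metricK.mtopology \<sigma> (R l) sequentially"
    unfolding metricK.limitin_metric_dist_null using lK \<sigma>(1) by simp
  then show "\<exists>x. limitin metricK.mtopology \<sigma> x sequentially" ..
qed

lemma hilbertK: "hilbert_space_on K formA"
  unfolding hilbert_space_on_def
proof (intro conjI ballI allI impI)
  fix x y assume "x \<in> K"
  show "formA x y = cnj (formA y x)" by (rule formA_commute)
  assume "x \<noteq> 0"
  then have "R x \<noteq> 0" by (metis R_R R_simps(5))
  then show "0 < Re (formA x x)"
    using formA_K[OF \<open>x \<in> K\<close>] by simp
qed (rule subspaceK mcompleteK formA_add_left formA_scaleC_left)+

text \<open>The projection onto \<open>K\<close> along the span of \<open>f\<close> and
  \<open>g\<close>. As both vectors are null, the coefficient of \<open>f\<close> is found by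
  pairing with \<open>g\<close> and conversely; the factor 2 compensates
  \<open>A(f, g) = -1/2\<close>.\<close>

definition P where "P v = v + (2 * formA v g) *\<^sub>C f + (2 * formA v f) *\<^sub>C g"

lemma P_in_K: "P v \<in> K"
  unfolding memK P_def by (simp add: formA_simps ff gg fg gf)

lemma P_decomposition: "v = (- 2 * formA v g) *\<^sub>C f + (- 2 * formA v f) *\<^sub>C g + P v"
  unfolding P_def by (simp add: scaleC_simps)

lemma direct_sumK: "direct_sum (complex_vector.span {f, g}) K"
proof -
  have "\<exists>m\<in>complex_vector.span {f, g}. \<exists>n\<in>K. v = m + n" for v
  proof -
    have "(- 2 * formA v g) *\<^sub>C f + (- 2 * formA v f) *\<^sub>C g \<in> complex_vector.span {f, g}"
      by (intro complex_vector.span_add complex_vector.span_scale complex_vector.span_base) auto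
    then show ?thesis
      using P_decomposition[of v] P_in_K[of v] by blast
  qed
  moreover have "v = 0" if span: "v \<in> complex_vector.span {f, g}" and "v \<in> K" for v
  proof -
    obtain a b where "v = a *\<^sub>C f + b *\<^sub>C g"
      using span by (auto simp: complex_vector.span_insert algebra_simps)
    with \<open>v \<in> K\<close> show ?thesis
      by (simp add: memK formA_simps ff gg fg gf)
  qed
  ultimately show ?thesis
    unfolding direct_sum_def
    using complex_vector.subspace_0[OF subspaceK]
    by (auto simp: subspaceK complex_vector.span_zero complex_vector.subspace_span)
qed

end


section \<open>Eigenvalues, eigenspaces and the splitting of \<open>T\<close>\<close>

locale hyperbolic_pair = light_pair f g t
  for f g :: "'a::complex_hilbert \<times> complex" and t +
  fixes T :: "'a \<times> complex \<Rightarrow> 'a \<times> complex" and lam mu :: complex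
  assumes T: "T \<in> isometries" and Tf: "T f = lam *\<^sub>C f" and Tg: "T g = mu *\<^sub>C g"
    and lam_off_circle: "cmod lam \<noteq> 1"
begin

lemmas T_simps = bounded_clinear_simps[OF isometriesD(1)[OF T]]
lemmas T_formA = isometriesD(3)[OF T]
lemmas inv_T = inv_isometry_linear[OF T]

lemma eigenvalue_product: "lam * cnj mu = 1" "mu * cnj lam = 1"
proof -
  show "lam * cnj mu = 1"
    using T_formA[of f g] by (simp add: Tf Tg formA_simps fg mult.commute)
  then show "mu * cnj lam = 1"
    by (metis complex_cnj_cnj complex_cnj_mult complex_cnj_one mult.commute)
qed

lemma nonzero: "lam \<noteq> 0" "mu \<noteq> 0"
  using eigenvalue_product by auto

lemma cmod_mu: "cmod mu = inverse (cmod lam)"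
  using arg_cong[OF eigenvalue_product(2), of cmod] nonzero by (simp add: norm_mult field_simps)

lemma mu_off_circle: "cmod mu \<noteq> 1"
  using lam_off_circle by (simp add: cmod_mu)

lemma lam_cnj_lam: "lam * cnj lam \<noteq> 1"
proof
  assume "lam * cnj lam = 1"
  then have "complex_of_real ((cmod lam)\<^sup>2) = complex_of_real 1"
    by (simp only: complex_norm_square of_real_1)
  then have "(cmod lam)\<^sup>2 = 1"
    unfolding of_real_eq_iff .
  then have "cmod lam = 1 \<or> cmod lam = - 1"
    by (simp add: power2_eq_1_iff)
  then show False
    using lam_off_circle norm_ge_zero[of lam] by linarith
qed

lemma eigenvalues_distinct: "lam \<noteq> mu"
  using eigenvalue_product lam_cnj_lam by auto

text \<open>Every result on \<open>f\<close> and \<open>lam\<close> thereby also serves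
  \<open>g\<close> and \<open>mu\<close>.\<close>

lemma swap: "hyperbolic_pair g f t T mu lam"
  by unfold_locales (use ff gg gf snd_fg t_pos T Tf Tg mu_off_circle in \<open>auto simp: add.commute\<close>)

text \<open>Invariance gives \<open>A(v, f) = cnj lam * A(T v, f)\<close>, and the inverse of
  \<open>cnj lam\<close> is \<open>mu\<close>: pairing with \<open>f\<close> brings out the
  eigenvalue of \<open>g\<close>.\<close>

lemma T_products: "formA (T v) f = mu * formA v f" "formA (T v) g = lam * formA v g"
proof -
  have "formA v f = cnj lam * formA (T v) f" "formA v g = cnj mu * formA (T v) g"
    using T_formA[of v f] T_formA[of v g] by (simp_all add: Tf Tg formA_simps)
  then show "formA (T v) f = mu * formA v f" "formA (T v) g = lam * formA v g"
    using eigenvalue_product by (simp_all flip: mult.assoc)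
qed

lemma T_in_K: "v \<in> K \<Longrightarrow> T v \<in> K"
  by (simp add: memK T_products)

lemma inv_T_in_K: "v \<in> K \<Longrightarrow> inv T v \<in> K"
  by (simp add: memK formA_inv_isometry[OF T] Tf Tg formA_simps)

lemma P_T: "P (T v) = T (P v)"
  unfolding P_def by (simp add: T_products T_simps Tf Tg mult_ac)

lemma operator_direct_sumK:
  "operator_direct_sum (complex_vector.span {f, g}) K T
    (restrict T (complex_vector.span {f, g})) (restrict T K)"
proof -
  have "T m \<in> complex_vector.span {f, g}" if span: "m \<in> complex_vector.span {f, g}" for m
  proof -
    obtain a b where "m = a *\<^sub>C f + b *\<^sub>C g"
      using span by (auto simp: complex_vector.span_insert algebra_simps)
    then show ?thesis
      by (auto simp: T_simps Tf Tg intro!: complex_vector.span_add complex_vector.span_scale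
          intro: complex_vector.span_base)
  qed
  then show ?thesis
    unfolding operator_direct_sum_def by (auto simp: T_in_K T_simps)
qed

lemma unitaryK: "unitary_on K formA (restrict T K)"
  unfolding unitary_on_def
proof (intro conjI exI[of _ "inv T"] ballI)
  show "clinear_on K (restrict T K)"
    unfolding clinear_on_def
    using subspaceK by (auto simp: T_in_K T_simps complex_vector.subspace_def)
  have "formA (T v) w = formA v (inv T w)" for v w
    by (metis formA_commute formA_inv_isometry[OF T])
  then show "adjoint_on K formA (restrict T K) (inv T)"
    unfolding adjoint_on_def by (auto simp: inv_T_in_K)
qed (simp_all add: inv_T_in_K inv_T)

text \<open>Since \<open>lam \<noteq> mu\<close>, pairing with \<open>f\<close> kills the
  \<open>g\<close> component of an eigenvector. Its component in \<open>K\<close> is scaled by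
  \<open>lam\<close> off the unit circle although \<open>T\<close> preserves the form, so it is
  null, hence 0 by definiteness on \<open>K\<close>.\<close>

lemma eigenspace_lam: "eigenspace T lam = complex_vector.span {f}"
proof (intro equalityI subsetI)
  fix v assume "v \<in> eigenspace T lam"
  then have Tv: "T v = lam *\<^sub>C v" by (simp add: eigenspace_def)
  have vf: "formA v f = 0"
    using T_products(1)[of v] eigenvalues_distinct by (simp add: Tv formA_simps)
  have "T (P v) = lam *\<^sub>C P v"
    unfolding P_T[symmetric] unfolding Tv P_def by (simp add: formA_simps scaleC_simps mult_ac)
  then have "formA (P v) (P v) = lam * cnj lam * formA (P v) (P v)"
    using T_formA[of "P v" "P v"] by (simp add: formA_scaleC_left formA_scaleC_right mult_ac)
  then have "formA (P v) (P v) = 0"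
    using lam_cnj_lam by simp
  then have "R (P v) = 0"
    using formA_K[OF P_in_K] by simp
  then have "P v = 0" by (metis R_R R_simps(5))
  then have "v = (- 2 * formA v g) *\<^sub>C f"
    using P_decomposition[of v] vf by simp
  then show "v \<in> complex_vector.span {f}"
    by (metis complex_vector.span_base complex_vector.span_scale singletonI)
next
  fix v assume "v \<in> complex_vector.span {f}"
  then show "v \<in> eigenspace T lam"
    by (auto simp: complex_vector.span_singleton eigenspace_def T_simps Tf mult.commute)
qed

lemma light_like_f: "light_like f"
  unfolding light_like_def formQ_def using ff fg by auto

lemma eigenvalue_lam: "eigenvalue T lam"
  using light_like_f Tf unfolding light_like_def eigenvalue_def by blast

lemma dim_eigenspace_lam: "complex_vector.dim (eigenspace T lam) = 1"
proof -
  have "f \<noteq> 0" using light_like_f by (simp add: light_like_def)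
  then show ?thesis
    unfolding eigenspace_lam
    by (subst complex_vector.dim_span_eq_card_independent) simp_all
qed


subsection \<open>The spectrum\<close>

lemma formA_T_diff: "formA (T x - T y) (T x - T y) = formA (x - y) (x - y)"
  using T_formA[of "x - y" "x - y"] by (simp add: T_simps)

lemma resolvent_surj_K:
  assumes c: "cmod c \<noteq> 1" and w: "w \<in> K"
  shows "\<exists>v\<in>K. T v - c *\<^sub>C v = w"
proof (cases "cmod c < 1")
  case True
  \<comment> \<open>Solving for the \<open>v\<close> under \<open>T\<close> gives a map that scales
    \<open>dK\<close> by \<open>cmod c\<close>.\<close>
  define F where "F v = inv T (w + c *\<^sub>C v)" for v
  have "F \<in> K \<rightarrow> K"
    using w subspaceK by (auto simp: F_def inv_T_in_K complex_vector.subspace_def)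
  moreover have "dK (F x) (F y) = cmod c * dK x y" for x y
  proof -
    have "T (F x) - T (F y) = c *\<^sub>C (x - y)"
      by (simp add: F_def inv_T(1) scaleC_simps)
    then have "formA (F x - F y) (F x - F y) = (c * cnj c) * formA (x - y) (x - y)"
      using formA_T_diff[of "F x" "F y"] by (simp add: formA_scaleC_left formA_scaleC_right mult_ac)
    then show ?thesis
      by (simp add: norm_mult real_sqrt_mult)
  qed
  ultimately obtain v where "v \<in> K" "F v = v"
    using metricK.Banach_fixedpoint_thm[OF mcompleteK, of F "cmod c"] True w
    by (metis empty_iff order_refl)
  then have "T v = w + c *\<^sub>C v"
    unfolding F_def by (metis inv_T(1))
  then have "T v - c *\<^sub>C v = w" by simp
  with \<open>v \<in> K\<close> show ?thesis by blast
next
  case False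
  then have c: "cmod c > 1" using c by simp
  then have c0: "c \<noteq> 0" by auto
  \<comment> \<open>Solving for the other \<open>v\<close> instead scales \<open>dK\<close> by the
    inverse of \<open>cmod c\<close>.\<close>
  define F where "F v = inverse c *\<^sub>C (T v - w)" for v
  have "F \<in> K \<rightarrow> K"
    using w T_in_K
    by (auto simp: F_def intro!: complex_vector.subspace_diff complex_vector.subspace_scale subspaceK)
  moreover have "dK (F x) (F y) = cmod (inverse c) * dK x y" for x y
  proof -
    have "F x - F y = inverse c *\<^sub>C (T x - T y)"
      by (simp add: F_def scaleC_simps)
    then have "formA (F x - F y) (F x - F y) = (inverse c * cnj (inverse c)) * formA (x - y) (x - y)"
      by (simp only: formA_scaleC_left formA_scaleC_right formA_T_diff mult_ac)
    then show ?thesis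
      by (simp add: norm_mult real_sqrt_mult norm_inverse)
  qed
  moreover have "cmod (inverse c) < 1"
    using c by (simp add: norm_inverse inverse_less_1_iff)
  ultimately obtain v where "v \<in> K" "F v = v"
    using metricK.Banach_fixedpoint_thm[OF mcompleteK, of F "cmod (inverse c)"] w
    by (metis empty_iff order_refl)
  then have "c *\<^sub>C v = T v - w"
    unfolding F_def using c0 by (metis right_inverse scaleC_one scaleC_scaleC)
  then have "T v - c *\<^sub>C v = w" by simp
  with \<open>v \<in> K\<close> show ?thesis by blast
qed

text \<open>On \<open>K\<close>, \<open>T\<close> preserves \<open>norm (R v)\<close>, the Hilbert
  norm of \<open>K\<close>; the bound is then the reverse triangle inequality.\<close>

lemma resolvent_bound_K:
  assumes v: "v \<in> K"
  shows "\<bar>1 - cmod c\<bar> * norm (R v) \<le> norm (R (T v - c *\<^sub>C v))"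
proof -
  have "norm (R (T v)) = norm (R v)"
    using T_formA[of v v] formA_K[OF v] formA_K[OF T_in_K[OF v]]
    by (simp del: of_real_power)
  then have "norm (R (T v)) - norm (c *\<^sub>C R v) = (1 - cmod c) * norm (R v)"
    by (simp add: norm_scaleC left_diff_distrib)
  then have "\<bar>1 - cmod c\<bar> * norm (R v) = \<bar>norm (R (T v)) - norm (c *\<^sub>C R v)\<bar>"
    by (simp add: abs_mult)
  also have "\<dots> \<le> norm (R (T v) - c *\<^sub>C R v)"
    by (rule norm_triangle_ineq3)
  finally show ?thesis by (simp add: R_simps)
qed

text \<open>\<open>T - c\<close> respects the splitting into the lines of \<open>f\<close> and
  \<open>g\<close> and \<open>K\<close>, so it is bounded below and solved on each component
  separately.\<close>

lemma not_in_spectrum: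
  assumes c: "cmod c \<noteq> 1" "c \<noteq> lam" "c \<noteq> mu"
  shows "c \<notin> spectrum T"
proof -
  \<comment> \<open>\<open>R\<close> is its own inverse, so \<open>C\<close> controls the passage
    between \<open>norm v\<close> and \<open>norm (R v)\<close> in both directions.\<close>
  obtain C where C: "\<And>v. norm (R v) \<le> norm v * C" "C \<ge> 0"
    using R_bounded bounded_linear.nonneg_bounded unfolding bounded_clinear_def by blast
  define L where "L v = T v - c *\<^sub>C v" for v
  have Lg: "formA (L v) g = (lam - c) * formA v g" and Lf: "formA (L v) f = (mu - c) * formA v f" for v
    by (simp_all add: L_def formA_simps T_products algebra_simps)
  have PL: "P (L v) = L (P v)" for v
    unfolding L_def P_T[symmetric] by (simp add: P_def formA_simps scaleC_simps mult_ac)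
  \<comment> \<open>The three summands bound the components of \<open>v\<close> along
    \<open>f\<close>, along \<open>g\<close> and in \<open>K\<close>, in terms of
    \<open>norm (L v)\<close>.\<close>
  define B where "B = 4 * norm g / cmod (lam - c) * norm f + 4 * norm f / cmod (mu - c) * norm g
      + C * ((C * (1 + 4 * norm g * norm f + 4 * norm f * norm g)) / \<bar>1 - cmod c\<bar>)"
  have normP: "norm (P v) \<le> (1 + 4 * norm g * norm f + 4 * norm f * norm g) * norm v" for v
  proof -
    have "norm (P v) \<le> norm v + 2 * cmod (formA v g) * norm f + 2 * cmod (formA v f) * norm g"
      unfolding P_def
      by (intro order.trans[OF norm_triangle_ineq] add_mono) (simp_all add: norm_scaleC norm_mult)
    also have "\<dots> \<le> norm v + 2 * (2 * norm v * norm g) * norm f + 2 * (2 * norm v * norm f) * norm g"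
      by (intro add_mono mult_right_mono mult_left_mono cmod_formA_le) auto
    finally show ?thesis by (simp add: algebra_simps)
  qed
  have bound: "norm v \<le> B * norm (L v)" for v
  proof -
    have "cmod (formA v g) = cmod (formA (L v) g) / cmod (lam - c)"
      using c(2) by (simp add: Lg norm_mult)
    also have "\<dots> \<le> 2 * norm (L v) * norm g / cmod (lam - c)"
      by (intro divide_right_mono cmod_formA_le) simp
    finally have "cmod (formA v g) * (2 * norm f) \<le> 2 * norm (L v) * norm g / cmod (lam - c) * (2 * norm f)"
      by (rule mult_right_mono) simp
    then have 1: "2 * cmod (formA v g) * norm f \<le> 4 * norm g / cmod (lam - c) * norm f * norm (L v)"
      by (simp add: mult_ac)
    have "cmod (formA v f) = cmod (formA (L v) f) / cmod (mu - c)"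
      using c(3) by (simp add: Lf norm_mult)
    also have "\<dots> \<le> 2 * norm (L v) * norm f / cmod (mu - c)"
      by (intro divide_right_mono cmod_formA_le) simp
    finally have "cmod (formA v f) * (2 * norm g) \<le> 2 * norm (L v) * norm f / cmod (mu - c) * (2 * norm g)"
      by (rule mult_right_mono) simp
    then have 2: "2 * cmod (formA v f) * norm g \<le> 4 * norm f / cmod (mu - c) * norm g * norm (L v)"
      by (simp add: mult_ac)
    have "\<bar>1 - cmod c\<bar> * norm (R (P v)) \<le> norm (R (P (L v)))"
      using resolvent_bound_K[OF P_in_K] unfolding PL unfolding L_def .
    also have "\<dots> \<le> norm (P (L v)) * C" by (rule C)
    also have "\<dots> \<le> (1 + 4 * norm g * norm f + 4 * norm f * norm g) * norm (L v) * C"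
      by (intro mult_right_mono normP C)
    finally have "norm (R (P v)) \<le>
        (C * (1 + 4 * norm g * norm f + 4 * norm f * norm g)) / \<bar>1 - cmod c\<bar> * norm (L v)"
      using c(1) by (simp add: pos_le_divide_eq mult_ac)
    from mult_left_mono[OF this C(2)] have "norm (R (P v)) * C \<le>
        C * ((C * (1 + 4 * norm g * norm f + 4 * norm f * norm g)) / \<bar>1 - cmod c\<bar>) * norm (L v)"
      by (simp only: mult_ac)
    then have 3: "norm (P v) \<le>
        C * ((C * (1 + 4 * norm g * norm f + 4 * norm f * norm g)) / \<bar>1 - cmod c\<bar>) * norm (L v)"
      using C(1)[of "R (P v)"] by simp
    have "norm v = norm ((- 2 * formA v g) *\<^sub>C f + (- 2 * formA v f) *\<^sub>C g + P v)"
      by (rule arg_cong[OF P_decomposition])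
    also have "\<dots> \<le> norm ((- 2 * formA v g) *\<^sub>C f) + norm ((- 2 * formA v f) *\<^sub>C g) + norm (P v)"
      by (rule norm_triangle_le[OF add_right_mono[OF norm_triangle_ineq]])
    also have "\<dots> = 2 * cmod (formA v g) * norm f + 2 * cmod (formA v f) * norm g + norm (P v)"
      by (simp add: norm_scaleC norm_mult)
    also have "\<dots> \<le> B * norm (L v)"
      unfolding B_def distrib_right by (intro add_mono 1 2 3)
    finally show ?thesis .
  qed
  have surj: "\<exists>v. L v = w" for w
  proof -
    obtain k where k: "k \<in> K" "L k = P w"
      using resolvent_surj_K[OF c(1) P_in_K] unfolding L_def by blast
    have scale: "L (a *\<^sub>C f) = (a * (lam - c)) *\<^sub>C f" "L (a *\<^sub>C g) = (a * (mu - c)) *\<^sub>C g"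
      and add: "L (x + y) = L x + L y" for a x y
      by (simp_all add: L_def T_simps Tf Tg scaleC_simps algebra_simps)
    \<comment> \<open>The coefficients of \<open>w\<close> from \<open>P_decomposition\<close> are
      divided by \<open>lam - c\<close> and \<open>mu - c\<close>; \<open>k\<close> takes care of
      the part in \<open>K\<close>.\<close>
    have "L ((- 2 * formA w g / (lam - c)) *\<^sub>C f + (- 2 * formA w f / (mu - c)) *\<^sub>C g + k) = w"
      using P_decomposition[of w] c(2,3) unfolding add scale k by simp
    then show ?thesis by blast
  qed
  show ?thesis
    using spectrum_complementI[OF isometriesD(1)[OF T]] bound surj unfolding L_def by blast
qed


subsection \<open>Normality up to conjugacy\<close>

lemma reflection_q: "reflection q f = - g" "reflection q g = - f" "v \<in> K \<Longrightarrow> reflection q v = v"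
  by (simp_all add: reflection_def q_products)
    (simp_all add: q_def memK formA_simps)

text \<open>The map composed with \<open>T\<close> is the adjoint of \<open>R T R\<close>
  transported back by \<open>R\<close>. The reflection in \<open>q\<close> swaps the lines of
  \<open>f\<close> and \<open>g\<close> and fixes \<open>K\<close>, so this map acts as
  \<open>inverse mu\<close> on \<open>f\<close>, \<open>inverse lam\<close> on \<open>g\<close> and
  \<open>inv T\<close> on \<open>K\<close>, and commutes with \<open>T\<close> on each part.\<close>

lemma T_commutes:
  "T (reflection q (inv T (reflection q v))) = reflection q (inv T (reflection q (T v)))"
proof -
  define U where "U v = reflection q (inv T (reflection q v))" for v
  have add: "U (x + y) = U x + U y" and scale: "U (a *\<^sub>C x) = a *\<^sub>C U x" for x y a
    by (simp_all add: U_def reflection_add reflection_scaleC inv_T)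
  have neg: "reflection q (- x) = - reflection q x" for x
    using reflection_scaleC[of q "-1" x] by (simp add: scaleC_minus_left)
  have inv_neg: "inv T (- x) = - inv T x" for x
    using inv_T(4)[of "-1" x] by (simp add: scaleC_minus_left)
  have "inv T f = inverse lam *\<^sub>C f" "inv T g = inverse mu *\<^sub>C g"
    using inv_T(2)[of "inverse lam *\<^sub>C f"] inv_T(2)[of "inverse mu *\<^sub>C g"] nonzero
    by (simp_all add: T_simps Tf Tg)
  then have Uf: "U f = inverse mu *\<^sub>C f" and Ug: "U g = inverse lam *\<^sub>C g"
    by (simp_all add: U_def reflection_q neg inv_neg reflection_scaleC scaleC_minus_right)
  have UK: "U k = inv T k" if "k \<in> K" for k
    using that by (simp add: U_def reflection_q inv_T_in_K)
  obtain a b k where v: "v = a *\<^sub>C f + b *\<^sub>C g + k" and k: "k \<in> K"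
    using P_decomposition P_in_K by blast
  have "T (U v) = U (T v)"
    unfolding v using k
    by (simp add: add scale T_simps Tf Tg Uf Ug UK T_in_K inv_T(1,2) mult_ac)
  then show ?thesis by (simp add: U_def)
qed

lemma normal_conjugate: "normal_on UNIV cinner (R \<circ> T \<circ> inv R)"
proof -
  let ?N = "R \<circ> T \<circ> R" and ?J = "reflection (0, 1)"
  have N: "?N \<in> isometries"
    by (intro isometry_compose R_isometry T)
  have inv_N: "inv ?N = R \<circ> inv T \<circ> R"
    by (rule inv_unique_comp) (simp_all add: fun_eq_iff inv_T)
  \<comment> \<open>As \<open>R q = (0, 1)\<close>, moving the axis reflection past \<open>R\<close>
    turns it into the reflection in \<open>q\<close>; this reduces normality to
    \<open>T_commutes\<close>.\<close>
  have J_R: "?J (R v) = R (reflection q v)" for v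
    using reflection_conjugate[OF R_isometry, of q v] by (simp add: R_q)
  have "?N (?J (inv ?N (?J (R v)))) = ?J (inv ?N (?J (?N (R v))))" for v
    unfolding inv_N by (simp add: J_R T_commutes)
  then have "?N (?J (inv ?N (?J v))) = ?J (inv ?N (?J (?N v)))" for v
    by (metis R_R)
  moreover have "clinear_on UNIV ?N"
    unfolding clinear_on_def by (simp add: R_simps T_simps)
  ultimately show ?thesis
    unfolding normal_on_def inv_R using adjoint_isometry[OF N] by blast
qed

text \<open>A unitary operator preserves norms, but the eigenvector \<open>R f\<close> is stretched
  by \<open>cmod lam \<noteq> 1\<close>.\<close>

lemma not_unitary_conjugate: "\<not> unitary_on UNIV cinner (R \<circ> T \<circ> inv R)"
proof
  let ?N = "R \<circ> T \<circ> inv R"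
  assume "unitary_on UNIV cinner ?N"
  then obtain U where "\<And>x y. cinner (?N x) y = cinner x (U y)" "\<And>x. U (?N x) = x"
    unfolding unitary_on_def adjoint_on_def by blast
  then have "cinner (?N v) (?N v) = cinner v v" for v
    by metis
  then have "norm (?N (R f)) = norm (R f)"
    unfolding cinner_self of_real_eq_iff by (simp add: power2_eq_iff_nonneg)
  then have "cmod lam * norm (R f) = norm (R f)"
    by (simp add: inv_R Tf R_simps norm_scaleC)
  moreover have "R f \<noteq> 0"
    using light_like_f unfolding light_like_def by (metis R_R R_simps(5))
  ultimately show False
    using lam_off_circle by simp
qed

end


section \<open>Hyperbolic isometries\<close>

lemma span_scaled_pair:
  assumes "a \<noteq> 0" "b \<noteq> 0"
  shows "complex_vector.span {a *\<^sub>C u, b *\<^sub>C v} = complex_vector.span {u, v}"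
proof -
  have "u = inverse a *\<^sub>C a *\<^sub>C u" "v = inverse b *\<^sub>C b *\<^sub>C v"
    using assms by simp_all
  then have "u \<in> complex_vector.span {a *\<^sub>C u, b *\<^sub>C v}" "v \<in> complex_vector.span {a *\<^sub>C u, b *\<^sub>C v}"
    by (metis complex_vector.span_base complex_vector.span_scale insertI1 insertI2)+
  moreover have "a *\<^sub>C u \<in> complex_vector.span {u, v}" "b *\<^sub>C v \<in> complex_vector.span {u, v}"
    by (auto intro: complex_vector.span_scale complex_vector.span_base)
  ultimately show ?thesis
    unfolding complex_vector.span_eq by simp
qed

lemma light_pair_normalization:
  assumes y: "norm y\<^sub>1 = 1" "norm y\<^sub>2 = 1" "y\<^sub>1 \<noteq> y\<^sub>2"
  obtains \<alpha> \<beta> t where "\<alpha> \<noteq> 0" "\<beta> \<noteq> 0" "light_pair (\<alpha> *\<^sub>C (y\<^sub>1, 1)) (\<beta> *\<^sub>C (y\<^sub>2, 1)) t"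
proof -
  define a where "a = formA (y\<^sub>1, 1) (y\<^sub>2, 1)"
  \<comment> \<open>Otherwise two unit vectors would have inner product 1 and therefore
    coincide.\<close>
  have a: "a \<noteq> 0"
  proof
    assume "a = 0"
    then have 1: "cinner y\<^sub>1 y\<^sub>2 = 1" by (simp add: a_def formA_def)
    then have "cinner y\<^sub>2 y\<^sub>1 = 1" using cinner_commute[of y\<^sub>2 y\<^sub>1] by simp
    with 1 have "cinner (y\<^sub>1 - y\<^sub>2) (y\<^sub>1 - y\<^sub>2) = 0"
      by (simp add: cinner_diff_left cinner_diff_right cinner_self[of y\<^sub>1] cinner_self[of y\<^sub>2] y)
    then show False
      using y(3) by (simp add: cinner_self)
  qed
  have null: "formA (y\<^sub>1, 1) (y\<^sub>1, 1) = 0" "formA (y\<^sub>2, 1) (y\<^sub>2, 1) = 0"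
    by (simp_all add: formA_self y)
  have null_scaled: "formA (s *\<^sub>C (y\<^sub>1, 1)) (s *\<^sub>C (y\<^sub>1, 1)) = 0"
    "formA (s *\<^sub>C (y\<^sub>2, 1)) (s *\<^sub>C (y\<^sub>2, 1)) = 0" for s
    by (simp_all only: formA_scaleC_left formA_scaleC_right null mult_zero_right)
  have a': "formA (y\<^sub>2, 1) (y\<^sub>1, 1) = cnj a"
    unfolding a_def by (rule formA_commute)
  \<comment> \<open>Chosen so that scaling the first vector by \<open>c\<close> makes the product of
    the two vectors -1/2; \<open>z\<close> is the last coordinate of the resulting sum
    \<open>v\<close>.\<close>
  define c where "c = - 1 / (2 * a)"
  define z where "z = c + 1"
  define v where "v = c *\<^sub>C (y\<^sub>1, 1::complex) + (y\<^sub>2, 1)"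
  have c: "c \<noteq> 0" "c * a = - 1 / 2"
    using a by (simp_all add: c_def)
  then have "cnj c * cnj a = - 1 / 2"
    by (simp flip: complex_cnj_mult)
  \<comment> \<open>\<open>Q(v) = -1\<close> keeps the last coordinate \<open>z\<close> away from
    0.\<close>
  with c have "formA v v = - 1"
    by (simp add: v_def formA_simps null a' a_def[symmetric])
  then have "complex_of_real ((norm (fst v))\<^sup>2 - (cmod (snd v))\<^sup>2) = complex_of_real (- 1)"
    unfolding formA_self by simp
  then have "(norm (fst v))\<^sup>2 - (cmod (snd v))\<^sup>2 = - 1"
    unfolding of_real_eq_iff .
  moreover have "(norm (fst v))\<^sup>2 \<ge> 0" by simp
  ultimately have "(cmod (snd v))\<^sup>2 > 0" by linarith
  moreover have "snd v = z"
    by (simp add: v_def z_def scaleC_prod_def scaleC_complex_def)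
  ultimately have z: "z \<noteq> 0" by auto
  \<comment> \<open>A common phase for both vectors: it leaves the form unchanged and rotates
    \<open>z\<close> to \<open>cmod z\<close>, which becomes \<open>t\<close>.\<close>
  define w where "w = cnj z / complex_of_real (cmod z)"
  have w: "w \<noteq> 0" "w * z = complex_of_real (cmod z)" "w * cnj w = 1"
  proof -
    show "w \<noteq> 0" using z by (simp add: w_def)
    show "w * z = complex_of_real (cmod z)"
      using z complex_norm_square[of z] by (simp add: w_def power2_eq_square field_simps)
    show "w * cnj w = 1"
      using z complex_norm_square[of z] by (simp add: w_def power2_eq_square field_simps)
  qed
  have "formA ((w * c) *\<^sub>C (y\<^sub>1, 1)) (w *\<^sub>C (y\<^sub>2, 1)) = (w * cnj w) * (c * a)"
    by (simp add: formA_simps a_def)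
  then have "light_pair ((w * c) *\<^sub>C (y\<^sub>1, 1)) (w *\<^sub>C (y\<^sub>2, 1)) (cmod z)"
    using z w(2) unfolding w(3) c(2)
    by unfold_locales
      (simp_all only: null_scaled, simp_all add: scaleC_prod_def scaleC_complex_def z_def algebra_simps)
  then show thesis
    by (rule that[rotated 2]) (use c w in simp_all)
qed

lemma hyperbolic_pair_of_fixed_points:
  assumes T: "T \<in> isometries" and "\<not> elliptic T"
    and y: "norm y\<^sub>1 = 1" "norm y\<^sub>2 = 1" "y\<^sub>1 \<noteq> y\<^sub>2"
    and eig: "eigenvector T (y\<^sub>1, 1)" "eigenvector T (y\<^sub>2, 1)"
  obtains \<alpha> \<beta> t c d where "\<alpha> \<noteq> 0" "\<beta> \<noteq> 0"
    "hyperbolic_pair (\<alpha> *\<^sub>C (y\<^sub>1, 1)) (\<beta> *\<^sub>C (y\<^sub>2, 1)) t T c d"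
proof -
  obtain \<alpha> \<beta> t where \<alpha>\<beta>: "\<alpha> \<noteq> 0" "\<beta> \<noteq> 0"
    and pair: "light_pair (\<alpha> *\<^sub>C (y\<^sub>1, 1)) (\<beta> *\<^sub>C (y\<^sub>2, 1)) t"
    using light_pair_normalization[OF y] .
  define f where "f = \<alpha> *\<^sub>C (y\<^sub>1, 1::complex)"
  define g where "g = \<beta> *\<^sub>C (y\<^sub>2, 1::complex)"
  interpret light_pair f g t
    using pair unfolding f_def g_def .
  note T_simps = bounded_clinear_simps[OF isometriesD(1)[OF T]]
  obtain c d where "T (y\<^sub>1, 1) = c *\<^sub>C (y\<^sub>1, 1)" "T (y\<^sub>2, 1) = d *\<^sub>C (y\<^sub>2, 1)"
    using eig unfolding eigenvector_def by blast
  then have Tf: "T f = c *\<^sub>C f" and Tg: "T g = d *\<^sub>C g"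
    by (simp_all add: f_def g_def T_simps mult.commute)
  have cd: "c * cnj d = 1"
    using isometriesD(3)[OF T, of f g] by (simp add: Tf Tg formA_simps fg mult.commute)
  have "cmod c \<noteq> 1"
  proof
    assume "cmod c = 1"
    then have "c * cnj c = 1"
      using complex_norm_square[of c] by simp
    with cd have "cnj c = cnj d" "c \<noteq> 0"
      by (metis mult_cancel_left mult_zero_left zero_neq_one)+
    then have "d = c" by simp
    then have Tq: "T q = c *\<^sub>C q"
      by (simp add: q_def T_simps Tf Tg scaleC_simps)
    \<comment> \<open>Dividing the eigenvector \<open>q\<close> by its last coordinate
      \<open>t\<close> gives \<open>(x, 1)\<close>; \<open>Q(q) = -1\<close> places \<open>x\<close>
      in the open ball.\<close>
    define x where "x = inverse (complex_of_real t) *\<^sub>C fst q"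
    have x: "(x, 1) = inverse (complex_of_real t) *\<^sub>C q"
      using t_pos by (simp add: x_def scaleC_prod_def scaleC_complex_def snd_q)
    have "eigenvector T (x, 1)"
      unfolding eigenvector_def
    proof (intro conjI exI[of _ c])
      show "T (x, 1) = c *\<^sub>C (x, 1)"
        unfolding x by (simp add: T_simps Tq mult.commute)
    qed (simp add: zero_prod_def)
    moreover have "norm x < 1"
    proof -
      have "(norm (fst q))\<^sup>2 < t\<^sup>2"
        by (simp add: norm_fst_q)
      then have "norm (fst q) < t"
        using t_pos by (simp add: power_less_imp_less_base)
      then show ?thesis
        using t_pos by (simp add: x_def norm_scaleC norm_inverse pos_divide_less_eq flip: divide_inverse_commute)
    qed
    ultimately have "elliptic T"
      unfolding elliptic_def using ball_action_fixed_iff[OF T, of x]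
      by (intro bexI[of _ x]) simp_all
    with \<open>\<not> elliptic T\<close> show False ..
  qed
  with T Tf Tg have "hyperbolic_pair f g t T c d"
    by unfold_locales
  then show thesis
    using that \<alpha>\<beta> unfolding f_def g_def by blast
qed

theorem theorem1p3:
  fixes T :: "'a::complex_hilbert \<times> complex \<Rightarrow> 'a \<times> complex"
  assumes "T \<in> isometries" and "hyperbolic T"
  shows
    "(\<exists>R\<in>isometries. normal_on UNIV cinner (R \<circ> T \<circ> inv R) \<and>
                      \<not> unitary_on UNIV cinner (R \<circ> T \<circ> inv R))
     \<and>
     (\<exists>r \<theta>. r > 0 \<and> r \<noteq> 1 \<and>
        (\<forall>c \<in> {rcis r \<theta>, rcis (inverse r) \<theta>}.
           c \<in> spectrum T \<and> eigenvalue T c \<and>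
           complex_vector.dim (eigenspace T c) = 1 \<and>
           (\<exists>v. light_like v \<and> eigenspace T c = complex_vector.span {v})) \<and>
        spectrum T - {rcis r \<theta>, rcis (inverse r) \<theta>} \<subseteq> sphere 0 1)
     \<and>
     card {y. light_like (y, 1) \<and> eigenvector T (y, 1)} = 2
     \<and>
     (\<forall>y\<^sub>1 y\<^sub>2.
        light_like (y\<^sub>1, 1) \<and> eigenvector T (y\<^sub>1, 1) \<and>
        light_like (y\<^sub>2, 1) \<and> eigenvector T (y\<^sub>2, 1) \<and> y\<^sub>1 \<noteq> y\<^sub>2 \<longrightarrow>
        (let M = complex_vector.span {(y\<^sub>1, 1), (y\<^sub>2, 1)};
             T\<^sub>1 = restrict T M;
             T\<^sub>2 = restrict T (dagger M)
         in direct_sum M (dagger M) \<and>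
            operator_direct_sum M (dagger M) T T\<^sub>1 T\<^sub>2 \<and>
            hilbert_space_on (dagger M) formA \<and>
            unitary_on (dagger M) formA T\<^sub>2))"
proof -
  note T = \<open>T \<in> isometries\<close>
  have hyp: "\<not> elliptic T" "card {x \<in> cball 0 1. ball_action T x = x} = 2"
    "{x \<in> cball 0 1. ball_action T x = x} \<subseteq> sphere 0 1"
    using \<open>hyperbolic T\<close> by (auto simp: hyperbolic_def)
  \<comment> \<open>Hyperbolicity puts all fixed points on the sphere, where \<open>(x, 1)\<close>
    is light-like.\<close>
  have fixed: "{y. light_like (y, 1) \<and> eigenvector T (y, 1)} = {x \<in> cball 0 1. ball_action T x = x}"
    using hyp(3) ball_action_fixed_iff[OF T] by (auto simp: light_like_normalized)
  obtain y\<^sub>1 y\<^sub>2 where y: "{y. light_like (y, 1) \<and> eigenvector T (y, 1)} = {y\<^sub>1, y\<^sub>2}" "y\<^sub>1 \<noteq> y\<^sub>2"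
    using hyp(2) unfolding fixed by (auto simp: card_2_iff)
  then have y': "norm y\<^sub>1 = 1" "norm y\<^sub>2 = 1" "eigenvector T (y\<^sub>1, 1)" "eigenvector T (y\<^sub>2, 1)"
    by (auto simp: light_like_normalized set_eq_iff)
  obtain f g t c d where "hyperbolic_pair f g t T c d"
    using hyperbolic_pair_of_fixed_points[OF T hyp(1) y'(1,2) y(2) y'(3,4)] .
  then interpret hyperbolic_pair f g t T c d .
  interpret swapped: hyperbolic_pair g f t T d c
    by (rule swap)
  have rcis: "rcis (cmod c) (Arg c) = c"
    by (rule rcis_cmod_Arg)
  \<comment> \<open>\<open>d\<close> is the inverse of \<open>cnj c\<close>, so it has the argument
    of \<open>c\<close> and the inverse modulus.\<close>
  have "inverse (cnj c) = rcis (inverse (cmod c)) (Arg c)"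
    by (subst rcis[symmetric], simp only: rcis_def) (simp add: cis_cnj)
  moreover have "d = inverse (cnj c)"
    using eigenvalue_product(2) nonzero by (simp add: field_simps)
  ultimately have rcis': "rcis (inverse (cmod c)) (Arg c) = d" by simp
  have "\<exists>r \<theta>. r > 0 \<and> r \<noteq> 1 \<and>
        (\<forall>c \<in> {rcis r \<theta>, rcis (inverse r) \<theta>}.
           c \<in> spectrum T \<and> eigenvalue T c \<and>
           complex_vector.dim (eigenspace T c) = 1 \<and>
           (\<exists>v. light_like v \<and> eigenspace T c = complex_vector.span {v})) \<and>
        spectrum T - {rcis r \<theta>, rcis (inverse r) \<theta>} \<subseteq> sphere 0 1"
  proof (intro exI conjI)
    show "0 < cmod c" "cmod c \<noteq> 1"
      using nonzero lam_off_circle by simp_all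
    show "\<forall>c \<in> {rcis (cmod c) (Arg c), rcis (inverse (cmod c)) (Arg c)}.
           c \<in> spectrum T \<and> eigenvalue T c \<and>
           complex_vector.dim (eigenspace T c) = 1 \<and>
           (\<exists>v. light_like v \<and> eigenspace T c = complex_vector.span {v})"
      unfolding rcis rcis'
      using eigenvalue_lam dim_eigenspace_lam light_like_f eigenspace_lam
        swapped.eigenvalue_lam swapped.dim_eigenspace_lam swapped.light_like_f
        swapped.eigenspace_lam eigenvalue_in_spectrum by blast
    show "spectrum T - {rcis (cmod c) (Arg c), rcis (inverse (cmod c)) (Arg c)} \<subseteq> sphere 0 1"
      unfolding rcis rcis' using not_in_spectrum by fastforce
  qed
  moreover have "direct_sum M (dagger M) \<and> operator_direct_sum M (dagger M) T (restrict T M) (restrict T (dagger M)) \<and>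
      hilbert_space_on (dagger M) formA \<and> unitary_on (dagger M) formA (restrict T (dagger M))"
    if x: "light_like (x\<^sub>1, 1)" "eigenvector T (x\<^sub>1, 1)" "light_like (x\<^sub>2, 1)" "eigenvector T (x\<^sub>2, 1)"
      "x\<^sub>1 \<noteq> x\<^sub>2" and M: "M = complex_vector.span {(x\<^sub>1, 1), (x\<^sub>2, 1)}" for x\<^sub>1 x\<^sub>2 M
  proof -
    have "norm x\<^sub>1 = 1" "norm x\<^sub>2 = 1"
      using x by (simp_all add: light_like_normalized)
    \<comment> \<open>The locale is instantiated afresh for the given pair; rescaling its vectors
      does not change \<open>M\<close>.\<close>
    then obtain \<alpha> \<beta> t c d where \<alpha>\<beta>: "\<alpha> \<noteq> 0" "\<beta> \<noteq> 0"
      and pair: "hyperbolic_pair (\<alpha> *\<^sub>C (x\<^sub>1, 1)) (\<beta> *\<^sub>C (x\<^sub>2, 1)) t T c d"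
      using hyperbolic_pair_of_fixed_points[OF T hyp(1) _ _ x(5,2,4)] by blast
    interpret p: hyperbolic_pair "\<alpha> *\<^sub>C (x\<^sub>1, 1)" "\<beta> *\<^sub>C (x\<^sub>2, 1)" t T c d
      by (rule pair)
    show ?thesis
      using p.direct_sumK p.operator_direct_sumK p.hilbertK p.unitaryK
      unfolding p.K_def span_scaled_pair[OF \<alpha>\<beta>] M by blast
  qed
  ultimately show ?thesis
    unfolding Let_def fixed
    using R_isometry normal_conjugate not_unitary_conjugate hyp(2) by blast
qed

end
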